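(* Let $X$ be the character table of a finite group $G$. Let $D$ be the diagonal matrix with the character degrees of $G$ along the diagonal (in the same order as they appear in $X$). Let $N$ be an arbitrary diagonal matrix such that $\tilde{X}=(D^{-1}XN)^{T}=NX^{T}D^{-1}$ is the character table of some group $G^{T}$. Then $N^{2}$ is the diagonal matrix with entries equal to the conjugacy class sizes of $G$ (in the same order as they appear in $X$).
   Context: The character table of a finite group is the square matrix of values of its complex irreducible characters, with rows indexed by the irreducible characters and columns indexed by the conjugacy classes. The superscript $T$ on a matrix denotes the matrix transpose; $G^{T}$ is simply the name of a group having $\tilde{X}$ as its character table.
   Formalization: The formal statement also assumes that the column of X̃ labelled by the trivial character of G is that of the identity class of G^T (true if both are listed first); with arbitrary orders the claim fails, e.g. G = C_3, N the diagonal of values of a nontrivial character. *)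

theory Defs
  imports "Jordan_Normal_Form.VS_Connect" "HOL-Algebra.Group_Action"
begin

definition mat_trace :: "'a :: comm_monoid_add mat \<Rightarrow> 'a" where
  "mat_trace A = (\<Sum>i<dim_row A. A $$ (i, i))"

text \<open>The unit group of the ring of \<open>n \<times> n\<close> complex matrices is the general linear group.\<close>

definition representation ::
    "('a, 'm) monoid_scheme \<Rightarrow> nat \<Rightarrow> ('a \<Rightarrow> complex mat) \<Rightarrow> bool" where
  "representation G n \<rho> \<longleftrightarrow> \<rho> \<in> hom G (units_of (ring_mat TYPE(complex) n ()))"

definition irreducible_representation ::
    "('a, 'm) monoid_scheme \<Rightarrow> nat \<Rightarrow> ('a \<Rightarrow> complex mat) \<Rightarrow> bool" where
  "irreducible_representation G n \<rho> \<longleftrightarrow>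
     representation G n \<rho> \<and> n > 0 \<and>
     (\<forall>W. VectorSpace.subspace class_ring W (module_vec TYPE(complex) n) \<longrightarrow>
          (\<forall>g \<in> carrier G. \<forall>w \<in> W. \<rho> g *\<^sub>v w \<in> W) \<longrightarrow>
          W = {0\<^sub>v n} \<or> W = carrier_vec n)"

text \<open>Characters are restricted to the carrier, so that equality of characters as HOL
  functions is equality on the group.\<close>

definition character_of ::
    "('a, 'm) monoid_scheme \<Rightarrow> ('a \<Rightarrow> complex mat) \<Rightarrow> 'a \<Rightarrow> complex" where
  "character_of G \<rho> = (\<lambda>g \<in> carrier G. mat_trace (\<rho> g))"

definition irreducible_characters :: "('a, 'm) monoid_scheme \<Rightarrow> ('a \<Rightarrow> complex) set" where
  "irreducible_characters G =
     {character_of G \<rho> | \<rho> n. irreducible_representation G n \<rho>}"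

definition trivial_character :: "('a, 'm) monoid_scheme \<Rightarrow> 'a \<Rightarrow> complex" where
  "trivial_character G = (\<lambda>g \<in> carrier G. 1)"

definition character_degree :: "('a, 'm) monoid_scheme \<Rightarrow> ('a \<Rightarrow> complex) \<Rightarrow> complex" where
  "character_degree G \<chi> = \<chi> \<one>\<^bsub>G\<^esub>"

definition conjugacy_classes :: "('a, 'm) monoid_scheme \<Rightarrow> 'a set set" where
  "conjugacy_classes G =
     orbits G (carrier G) (\<lambda>g. \<lambda>h \<in> carrier G. g \<otimes>\<^bsub>G\<^esub> h \<otimes>\<^bsub>G\<^esub> inv\<^bsub>G\<^esub> g)"

text \<open>A character table is determined by \<open>G\<close> only up to the order of its rows and columns.
  The lists \<open>\<chi>s\<close> and \<open>Ks\<close> record an order: they enumerate, without repetition, the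
  irreducible characters (rows) and the conjugacy classes (columns). The two lists
  always have the same length, but this is a theorem and not part of the definition.\<close>

definition character_table ::
    "('a, 'm) monoid_scheme \<Rightarrow> ('a \<Rightarrow> complex) list \<Rightarrow> 'a set list \<Rightarrow> complex mat \<Rightarrow> bool" where
  "character_table G \<chi>s Ks X \<longleftrightarrow>
     distinct \<chi>s \<and> set \<chi>s = irreducible_characters G \<and>
     distinct Ks \<and> set Ks = conjugacy_classes G \<and>
     X \<in> carrier_mat (length \<chi>s) (length Ks) \<and>
     (\<forall>i < length \<chi>s. \<forall>j < length Ks. \<forall>g \<in> Ks ! j. X $$ (i, j) = (\<chi>s ! i) g)"

definition degree_matrix ::
    "('a, 'm) monoid_scheme \<Rightarrow> ('a \<Rightarrow> complex) list \<Rightarrow> complex mat" where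
  "degree_matrix G \<chi>s = mat_diag (length \<chi>s) (\<lambda>i. character_degree G (\<chi>s ! i))"

definition class_size_matrix :: "'a set list \<Rightarrow> complex mat" where
  "class_size_matrix Ks = mat_diag (length Ks) (\<lambda>j. of_nat (card (Ks ! j)))"

text \<open>It is customary to list the trivial character first and the class of the identity
  first. Some such convention is needed when the character table of one group is compared
  with a matrix built from that of another, as here with
  \<open>(D\<^sup>-\<^sup>1 X N)\<^sup>T\<close>: its columns are labelled both by the irreducible characters \<open>\<chi>s\<close>
  of \<open>G\<close> and by the conjugacy classes \<open>Ls\<close> of the second group \<open>H\<close>. The predicate below asks only
  that the trivial character of \<open>G\<close> and the identity class of \<open>H\<close> label the same
  column, wherever it is; customarily ordered tables satisfy it with index \<open>0\<close>.
  Without it, taking \<open>G = H\<close> cyclic of order three and \<open>N\<close> the diagonal matrix of the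
  values of a nontrivial character gives a character table with permuted columns,
  although \<open>N\<^sup>2\<close> is not the identity matrix.\<close>

definition compatibly_ordered ::
    "('a, 'm) monoid_scheme \<Rightarrow> ('a \<Rightarrow> complex) list \<Rightarrow> ('b, 'k) monoid_scheme \<Rightarrow> 'b set list \<Rightarrow> bool"
  where
  "compatibly_ordered G \<chi>s H Ls \<longleftrightarrow>
     (\<exists>i < min (length \<chi>s) (length Ls). \<chi>s ! i = trivial_character G \<and> Ls ! i = {\<one>\<^bsub>H\<^esub>})"

end

theory Submission
  imports Defs "Jordan_Normal_Form.Spectral_Radius"
begin

text \<open>
  Let \<open>A = N X\<^sup>T D\<^sup>-\<^sup>1\<close> be the table of \<open>H\<close>, write \<open>n\<^sub>j\<close> for the diagonal entries of \<open>N\<close>, \<open>d\<^sub>i\<close>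
  for the degrees of the characters \<open>\<chi>\<^sub>i\<close> of \<open>G\<close>, and \<open>\<psi>\<^sub>j\<close> for the characters of \<open>H\<close>. The
  proof compares inverses of the two tables.

  Row orthogonality \<open>\<Sum>\<^sub>g \<chi>(g) \<psi>(g\<^sup>-\<^sup>1) = |G| \<delta>\<close>, proved from Schur's lemma by averaging matrix units over
  the group (\<open>irreducible_characters_orthogonal\<close>), says that \<open>X\<close> has the explicit right inverse
  \<open>C\<close> with entries \<open>|G|\<^sup>-\<^sup>1 \<Sum>\<^sub>g \<chi>\<^sub>i(g\<^sup>-\<^sup>1)\<close>, \<open>g\<close> running over the \<open>j\<close>th class
  (\<open>character_table_right_inverse\<close>). In the same way \<open>A\<close> has an explicit right inverse \<open>B\<close>.
  Transposing \<open>N X\<^sup>T D\<^sup>-\<^sup>1 B = 1\<close> and moving the square factor \<open>N\<close> to the other side shows that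
  \<open>N B\<^sup>T D\<^sup>-\<^sup>1\<close> is a left inverse of \<open>X\<close>; hence it equals the right inverse \<open>C\<close>
  (\<open>inverse_of_scaled_transpose\<close>).

  In the column of the trivial character of \<open>G\<close>, which is also that of the identity class of \<open>H\<close>,
  this identity reads \<open>|K\<^sub>j| / |G| = n\<^sub>j \<psi>\<^sub>j(1) / |H|\<close>. The same column of \<open>A\<close> gives \<open>\<psi>\<^sub>j(1) = n\<^sub>j\<close>, so
  \<open>n\<^sub>j\<^sup>2\<close> is proportional to the class size \<open>|K\<^sub>j|\<close>. The factor \<open>|H| / |G|\<close> is \<open>1\<close>: the column
  of \<open>X\<close> at the identity class of \<open>G\<close> consists of the degrees, so division by \<open>D\<close> makes the
  corresponding \<open>\<psi>\<^sub>j\<close> constant with value \<open>n\<^sub>j\<close>, and orthogonality of \<open>\<psi>\<^sub>j\<close> with itself forces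
  \<open>n\<^sub>j\<^sup>2 = 1\<close>, while this class has one element.
\<close>

section \<open>Matrices\<close>

lemma index_mult_mat_sum:
  assumes "A \<in> carrier_mat n m" "B \<in> carrier_mat m l" "i < n" "j < l"
  shows "(A * B) $$ (i, j) = (\<Sum>k<m. A $$ (i, k) * B $$ (k, j))"
  using assms by (auto simp: scalar_prod_def lessThan_atLeast0 intro!: sum.cong)

lemma mult_mat_zero_vec:
  assumes "A \<in> carrier_mat n m"
  shows "A *\<^sub>v 0\<^sub>v m = 0\<^sub>v n"
  using assms by (intro eq_vecI) auto

lemma smult_zero_vec: "c \<cdot>\<^sub>v 0\<^sub>v n = (0\<^sub>v n :: 'a :: mult_zero vec)"
  by (intro eq_vecI) auto

lemma col_eq_mult_unit_vec:
  fixes A :: "'a :: semiring_1 mat"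
  assumes "A \<in> carrier_mat n m" "j < m"
  shows "col A j = A *\<^sub>v unit_vec m j"
  using assms by (intro eq_vecI) auto

lemma mat_trace_comm:
  fixes A B :: "'a :: comm_semiring_1 mat"
  assumes A: "A \<in> carrier_mat n m" and B: "B \<in> carrier_mat m n"
  shows "mat_trace (A * B) = mat_trace (B * A)"
proof -
  have "mat_trace (A * B) = (\<Sum>i<n. \<Sum>k<m. A $$ (i, k) * B $$ (k, i))"
    unfolding mat_trace_def using A B
    by (intro sum.cong) (auto simp: index_mult_mat_sum[OF A B] simp del: index_mult_mat(1))
  also have "\<dots> = (\<Sum>k<m. \<Sum>i<n. B $$ (k, i) * A $$ (i, k))"
    by (subst sum.swap) (simp add: mult.commute)
  also have "\<dots> = mat_trace (B * A)"
    unfolding mat_trace_def using A B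
    by (intro sum.cong) (auto simp: index_mult_mat_sum[OF B A] simp del: index_mult_mat(1))
  finally show ?thesis .
qed

lemma surjective_mat_right_inverse:
  fixes S :: "'a :: comm_semiring_1 mat"
  assumes S: "S \<in> carrier_mat n m"
    and surj: "\<And>v. v \<in> carrier_vec n \<Longrightarrow> \<exists>w \<in> carrier_vec m. S *\<^sub>v w = v"
  obtains R where "R \<in> carrier_mat m n" "S * R = 1\<^sub>m n"
proof -
  have "\<forall>i. \<exists>w. w \<in> carrier_vec m \<and> S *\<^sub>v w = unit_vec n i"
    using surj by (meson unit_vec_carrier)
  then obtain w where w: "\<And>i. w i \<in> carrier_vec m" "\<And>i. S *\<^sub>v w i = unit_vec n i"
    by metis
  define R where "R = mat_of_cols m (map w [0..<n])"
  have R: "R \<in> carrier_mat m n" unfolding R_def by auto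
  have "S * R = 1\<^sub>m n"
  proof (rule mat_col_eqI)
    fix i assume "i < dim_col (1\<^sub>m n :: 'a mat)"
    then have i: "i < n" by simp
    have "col R i = w i" unfolding R_def using i w(1) by (subst col_mat_of_cols) auto
    then show "col (S * R) i = col (1\<^sub>m n) i"
      unfolding col_mult2[OF S R i] using i w(2) by simp
  qed (use S R in auto)
  with R show ?thesis by (rule that)
qed

lemma left_inverse_mat_eq_right_inverse_mat:
  fixes A :: "'a :: semiring_1 mat"
  assumes A: "A \<in> carrier_mat n m" and B: "B \<in> carrier_mat m n" and C: "C \<in> carrier_mat m n"
    and CA: "C * A = 1\<^sub>m m" and AB: "A * B = 1\<^sub>m n"
  shows "C = B"
proof -
  have "C = C * (A * B)" using C AB by simp
  also have "\<dots> = (C * A) * B" using A B C by (simp add: assoc_mult_mat)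
  also have "\<dots> = B" using B CA by simp
  finally show ?thesis .
qed

section \<open>Schur's lemma\<close>

lemma group_units_of_ring_mat: "group (units_of (ring_mat TYPE('a :: comm_ring_1) n ()))"
proof -
  interpret ring "ring_mat TYPE('a) n ()" by (rule ring_mat)
  show ?thesis by (rule units_group)
qed

context
  fixes G :: "('a, 'm) monoid_scheme" and n :: nat and \<rho> :: "'a \<Rightarrow> complex mat"
  assumes rep: "representation G n \<rho>"
begin

lemma representation_carrier: "g \<in> carrier G \<Longrightarrow> \<rho> g \<in> carrier_mat n n"
  using rep unfolding representation_def
  by (auto simp: units_of_def ring_mat_simps Units_def dest!: hom_in_carrier)

lemma representation_mult:
  "g \<in> carrier G \<Longrightarrow> h \<in> carrier G \<Longrightarrow> \<rho> (g \<otimes>\<^bsub>G\<^esub> h) = \<rho> g * \<rho> h"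
  using hom_mult[OF rep[unfolded representation_def]]
  by (simp add: units_of_def ring_mat_simps)

lemma representation_one: "group G \<Longrightarrow> \<rho> \<one>\<^bsub>G\<^esub> = 1\<^sub>m n"
  using hom_one[OF rep[unfolded representation_def] _ group_units_of_ring_mat]
  by (simp add: units_of_def ring_mat_simps)

end

lemma irreducible_representation_invariant_subspace:
  assumes irr: "irreducible_representation G n \<rho>"
    and "W \<subseteq> carrier_vec n" "0\<^sub>v n \<in> W"
    and "\<And>v w. v \<in> W \<Longrightarrow> w \<in> W \<Longrightarrow> v + w \<in> W"
    and "\<And>c v. v \<in> W \<Longrightarrow> c \<cdot>\<^sub>v v \<in> W"
    and inv: "\<And>g w. g \<in> carrier G \<Longrightarrow> w \<in> W \<Longrightarrow> \<rho> g *\<^sub>v w \<in> W"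
  shows "W = {0\<^sub>v n} \<or> W = carrier_vec n"
proof -
  have "VectorSpace.subspace class_ring W (module_vec TYPE(complex) n)"
    by (intro VectorSpace.subspace.intro vec_vs submodule.intro vec_module)
       (use assms in \<open>auto simp: module_vec_simps class_ring_simps\<close>)
  then show ?thesis using irr inv unfolding irreducible_representation_def by blast
qed

text \<open>The space carrying \<open>\<sigma>\<close> is the source and the one carrying \<open>\<rho>\<close> the target of the linear map \<open>S\<close>.\<close>

definition intertwiner ::
    "('a, 'm) monoid_scheme \<Rightarrow> nat \<Rightarrow> ('a \<Rightarrow> complex mat) \<Rightarrow> nat \<Rightarrow> ('a \<Rightarrow> complex mat) \<Rightarrow>
     complex mat \<Rightarrow> bool" where
  "intertwiner G n \<rho> m \<sigma> S \<longleftrightarrow>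
     S \<in> carrier_mat n m \<and> (\<forall>g \<in> carrier G. \<rho> g * S = S * \<sigma> g)"

text \<open>The kernel of an intertwiner is an invariant subspace of its source, so if the source is irreducible
  a single nonzero vector in the kernel makes the kernel everything.\<close>

lemma intertwiner_kernel:
  assumes \<sigma>: "irreducible_representation G m \<sigma>" and \<rho>: "representation G n \<rho>"
    and S: "intertwiner G n \<rho> m \<sigma> S"
    and w: "w \<in> carrier_vec m" "w \<noteq> 0\<^sub>v m" "S *\<^sub>v w = 0\<^sub>v n"
  shows "S = 0\<^sub>m n m"
proof -
  have Sc: "S \<in> carrier_mat n m" and comm: "\<And>g. g \<in> carrier G \<Longrightarrow> \<rho> g * S = S * \<sigma> g"
    using S unfolding intertwiner_def by auto
  have \<sigma>c: "\<And>g. g \<in> carrier G \<Longrightarrow> \<sigma> g \<in> carrier_mat m m"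
    using \<sigma> representation_carrier[of G m \<sigma>] unfolding irreducible_representation_def by simp
  define W where "W = {v \<in> carrier_vec m. S *\<^sub>v v = 0\<^sub>v n}"
  have "W = {0\<^sub>v m} \<or> W = carrier_vec m"
  proof (rule irreducible_representation_invariant_subspace[OF \<sigma>])
    fix g v assume g: "g \<in> carrier G" and v: "v \<in> W"
    then have vc: "v \<in> carrier_vec m" and Sv: "S *\<^sub>v v = 0\<^sub>v n" by (auto simp: W_def)
    have "S *\<^sub>v (\<sigma> g *\<^sub>v v) = (\<rho> g * S) *\<^sub>v v"
      unfolding comm[OF g] by (rule assoc_mult_mat_vec[OF Sc \<sigma>c[OF g] vc, symmetric])
    also have "\<dots> = \<rho> g *\<^sub>v (S *\<^sub>v v)"
      by (rule assoc_mult_mat_vec[OF representation_carrier[OF \<rho> g] Sc vc])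
    also have "\<dots> = 0\<^sub>v n"
      unfolding Sv by (rule mult_mat_zero_vec[OF representation_carrier[OF \<rho> g]])
    finally show "\<sigma> g *\<^sub>v v \<in> W" using vc \<sigma>c[OF g] by (simp add: W_def)
  qed (use Sc in \<open>auto simp: W_def mult_add_distrib_mat_vec[OF Sc] mult_mat_vec[OF Sc]
      mult_mat_zero_vec smult_zero_vec\<close>)
  then have all: "\<And>v. v \<in> carrier_vec m \<Longrightarrow> S *\<^sub>v v = 0\<^sub>v n"
    using w unfolding W_def by blast
  show ?thesis
  proof (rule mat_col_eqI)
    fix j assume "j < dim_col (0\<^sub>m n m :: complex mat)"
    then have "col S j = S *\<^sub>v unit_vec m j" using col_eq_mult_unit_vec[OF Sc] by simp
    also have "\<dots> = col (0\<^sub>m n m) j" using all \<open>j < _\<close> by simp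
    finally show "col S j = col (0\<^sub>m n m) j" .
  qed (use Sc in auto)
qed

text \<open>The image of an intertwiner is an invariant subspace of its target.\<close>

lemma intertwiner_image:
  assumes \<rho>: "irreducible_representation G n \<rho>" and \<sigma>: "representation G m \<sigma>"
    and S: "intertwiner G n \<rho> m \<sigma> S" and nz: "S \<noteq> 0\<^sub>m n m"
    and v: "v \<in> carrier_vec n"
  shows "\<exists>w \<in> carrier_vec m. S *\<^sub>v w = v"
proof -
  have Sc: "S \<in> carrier_mat n m" and comm: "\<And>g. g \<in> carrier G \<Longrightarrow> \<rho> g * S = S * \<sigma> g"
    using S unfolding intertwiner_def by auto
  have \<rho>c: "\<And>g. g \<in> carrier G \<Longrightarrow> \<rho> g \<in> carrier_mat n n"
    using \<rho> representation_carrier[of G n \<rho>] unfolding irreducible_representation_def by simp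
  note \<sigma>c = representation_carrier[OF \<sigma>]
  define W where "W = (\<lambda>w. S *\<^sub>v w) ` carrier_vec m"
  have "W = {0\<^sub>v n} \<or> W = carrier_vec n"
  proof (rule irreducible_representation_invariant_subspace[OF \<rho>])
    show "W \<subseteq> carrier_vec n" using Sc by (auto simp: W_def)
    show "0\<^sub>v n \<in> W" unfolding W_def
      by (rule image_eqI[of _ _ "0\<^sub>v m"]) (use mult_mat_zero_vec[OF Sc] in auto)
    show "u + v \<in> W" if "u \<in> W" "v \<in> W" for u v
      using that Sc unfolding W_def
      by (auto simp: mult_add_distrib_mat_vec[OF Sc, symmetric])
    show "c \<cdot>\<^sub>v u \<in> W" if "u \<in> W" for c u
      using that Sc unfolding W_def by (auto simp: mult_mat_vec[OF Sc, symmetric])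
    fix g u assume g: "g \<in> carrier G" and "u \<in> W"
    then obtain w where w: "w \<in> carrier_vec m" "u = S *\<^sub>v w" by (auto simp: W_def)
    have "\<rho> g *\<^sub>v u = (\<rho> g * S) *\<^sub>v w"
      unfolding w(2) by (rule assoc_mult_mat_vec[OF \<rho>c[OF g] Sc w(1), symmetric])
    also have "\<dots> = S *\<^sub>v (\<sigma> g *\<^sub>v w)"
      unfolding comm[OF g] by (rule assoc_mult_mat_vec[OF Sc \<sigma>c[OF g] w(1)])
    finally show "\<rho> g *\<^sub>v u \<in> W" using w \<sigma>c[OF g] by (auto simp: W_def)
  qed
  moreover have "W \<noteq> {0\<^sub>v n}"
  proof
    assume W0: "W = {0\<^sub>v n}"
    have "S = 0\<^sub>m n m"
    proof (rule mat_col_eqI)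
      fix j assume "j < dim_col (0\<^sub>m n m :: complex mat)"
      then have "col S j = S *\<^sub>v unit_vec m j" using col_eq_mult_unit_vec[OF Sc] by simp
      also have "\<dots> \<in> W" by (auto simp: W_def)
      finally show "col S j = col (0\<^sub>m n m) j" using W0 \<open>j < _\<close> by simp
    qed (use Sc in auto)
    with nz show False by simp
  qed
  ultimately have "W = carrier_vec n" by blast
  then show ?thesis using v unfolding W_def by (metis imageE)
qed

text \<open>A nonzero intertwiner \<open>S\<close> between irreducible representations is bijective, so \<open>\<rho> = S \<sigma> S\<^sup>-\<^sup>1\<close> and
  the traces agree. The inverse is built one side at a time, from surjectivity and then injectivity,
  which keeps the two dimensions independent.\<close>

lemma nonzero_intertwiner_character_eq:
  assumes \<rho>: "irreducible_representation G n \<rho>" and \<sigma>: "irreducible_representation G m \<sigma>"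
    and S: "intertwiner G n \<rho> m \<sigma> S" and nz: "S \<noteq> 0\<^sub>m n m"
  shows "character_of G \<rho> = character_of G \<sigma>"
proof -
  have rep: "representation G n \<rho>" "representation G m \<sigma>"
    using \<rho> \<sigma> unfolding irreducible_representation_def by auto
  have Sc: "S \<in> carrier_mat n m" and comm: "\<And>g. g \<in> carrier G \<Longrightarrow> \<rho> g * S = S * \<sigma> g"
    using S unfolding intertwiner_def by auto
  obtain R where R: "R \<in> carrier_mat m n" and SR: "S * R = 1\<^sub>m n"
    using surjective_mat_right_inverse[OF Sc intertwiner_image[OF \<rho> rep(2) S nz]] by blast
  have inj: "v = 0\<^sub>v m" if "v \<in> carrier_vec m" "S *\<^sub>v v = 0\<^sub>v n" for v
    using intertwiner_kernel[OF \<sigma> rep(1) S that(1) _ that(2)] nz by blast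
  \<comment> \<open>\<open>S (R S - 1) = (S R - 1) S = 0\<close>, and \<open>S\<close> is injective.\<close>
  have RS: "R * S = 1\<^sub>m m"
  proof (rule mat_col_eqI)
    fix j assume "j < dim_col (1\<^sub>m m :: complex mat)"
    then have j: "j < m" by simp
    let ?v = "col (R * S) j - unit_vec m j"
    have c: "col (R * S) j \<in> carrier_vec m" using R Sc j by simp
    have "S *\<^sub>v col (R * S) j = (S * R) *\<^sub>v col S j"
      unfolding col_mult2[OF R Sc j] using Sc j by (intro assoc_mult_mat_vec[OF Sc R, symmetric]) simp
    also have "\<dots> = S *\<^sub>v unit_vec m j"
      unfolding SR col_eq_mult_unit_vec[OF Sc j] using Sc j
      by (intro one_mult_mat_vec mult_mat_vec_carrier[OF Sc]) simp
    finally have "S *\<^sub>v ?v = 0\<^sub>v n"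
      using Sc c by (simp add: mult_minus_distrib_mat_vec)
    then have v0: "?v = 0\<^sub>v m" using inj c by simp
    have "col (R * S) j = unit_vec m j"
    proof (rule eq_vecI)
      fix i assume "i < dim_vec (unit_vec m j :: complex vec)"
      then show "col (R * S) j $ i = unit_vec m j $ i"
        using arg_cong[OF v0, of "\<lambda>v. v $ i"] c by simp
    qed (use R in simp)
    then show "col (R * S) j = col (1\<^sub>m m) j" using j by simp
  qed (use R Sc in auto)
  show ?thesis
  proof (rule ext)
    fix g
    show "character_of G \<rho> g = character_of G \<sigma> g"
    proof (cases "g \<in> carrier G")
      case g: True
      note \<rho>g = representation_carrier[OF rep(1) g] and \<sigma>g = representation_carrier[OF rep(2) g]
      have "mat_trace (\<rho> g) = mat_trace (\<rho> g * (S * R))" using \<rho>g SR by simp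
      also have "\<dots> = mat_trace ((\<rho> g * S) * R)" using \<rho>g Sc R by (simp add: assoc_mult_mat)
      also have "\<dots> = mat_trace (R * (S * \<sigma> g))"
        unfolding comm[OF g] using \<sigma>g Sc R by (intro mat_trace_comm[of _ n m]) auto
      also have "\<dots> = mat_trace ((R * S) * \<sigma> g)" using \<sigma>g Sc R by (simp add: assoc_mult_mat)
      also have "\<dots> = mat_trace (\<sigma> g)" using \<sigma>g RS by simp
      finally show ?thesis using g by (simp add: character_of_def)
    qed (simp add: character_of_def)
  qed
qed

text \<open>Over the complex numbers \<open>S\<close> has an eigenvalue \<open>c\<close>. Then \<open>S - c\<close> is an intertwiner with a nonzero
  kernel, hence zero.\<close>

lemma self_intertwiner_scalar:
  assumes \<rho>: "irreducible_representation G n \<rho>" and S: "intertwiner G n \<rho> n \<rho> S"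
  obtains c where "S = c \<cdot>\<^sub>m 1\<^sub>m n"
proof -
  have rep: "representation G n \<rho>" and n: "n > 0"
    using \<rho> unfolding irreducible_representation_def by auto
  have Sc: "S \<in> carrier_mat n n" and comm: "\<And>g. g \<in> carrier G \<Longrightarrow> \<rho> g * S = S * \<rho> g"
    using S unfolding intertwiner_def by auto
  obtain c where "eigenvalue S c"
    using spectrum_non_empty[OF Sc n] unfolding spectrum_def by auto
  then obtain v where v: "v \<in> carrier_vec n" "v \<noteq> 0\<^sub>v n" "char_matrix S c *\<^sub>v v = 0\<^sub>v n"
    using eigenvalue_char_matrix[OF Sc] by auto
  have eq: "char_matrix S c = S + (- c) \<cdot>\<^sub>m 1\<^sub>m n" using Sc by (simp add: char_matrix_def)
  have "intertwiner G n \<rho> n \<rho> (char_matrix S c)"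
    unfolding intertwiner_def
  proof (intro conjI ballI)
    fix g assume g: "g \<in> carrier G"
    note \<rho>g = representation_carrier[OF rep g]
    show "\<rho> g * char_matrix S c = char_matrix S c * \<rho> g"
      using \<rho>g Sc unfolding eq
      by (simp add: mult_add_distrib_mat[of _ n n] add_mult_distrib_mat[of _ n n] comm[OF g]
          mult_smult_distrib[of _ n n _ n] mult_smult_assoc_mat[of _ n n _ n])
  qed (use Sc eq in auto)
  then have "char_matrix S c = 0\<^sub>m n n"
    by (rule intertwiner_kernel[OF \<rho> rep _ v])
  then have zero: "S + (- c) \<cdot>\<^sub>m 1\<^sub>m n = 0\<^sub>m n n" unfolding eq .
  have "S $$ (i, j) = (c \<cdot>\<^sub>m 1\<^sub>m n) $$ (i, j)" if "i < n" "j < n" for i j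
    using that Sc arg_cong[OF zero, of "\<lambda>A. A $$ (i, j)"] by (simp split: if_splits)
  then have "S = c \<cdot>\<^sub>m 1\<^sub>m n" using Sc by (intro eq_matI) auto
  then show ?thesis by (rule that)
qed

section \<open>Row orthogonality\<close>

text \<open>This is \<open>\<Sum>\<^sub>g \<rho>(g) E\<^sub>a\<^sub>b \<sigma>(g\<^sup>-\<^sup>1)\<close> for the matrix unit \<open>E\<^sub>a\<^sub>b\<close>, written out entry by entry.\<close>

definition averaged_unit_mat ::
    "('a, 'm) monoid_scheme \<Rightarrow> nat \<Rightarrow> ('a \<Rightarrow> complex mat) \<Rightarrow> nat \<Rightarrow> ('a \<Rightarrow> complex mat) \<Rightarrow>
     nat \<Rightarrow> nat \<Rightarrow> complex mat" where
  "averaged_unit_mat G n \<rho> m \<sigma> a b =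
     mat n m (\<lambda>(c, d). \<Sum>g \<in> carrier G. \<rho> g $$ (c, a) * \<sigma> (inv\<^bsub>G\<^esub> g) $$ (b, d))"

text \<open>Multiplying by \<open>\<rho>(h)\<close> on the left and substituting \<open>g\<close> for \<open>h g\<close> in the sum produces the factor
  \<open>\<sigma>(h)\<close> on the right.\<close>

lemma intertwiner_averaged_unit_mat:
  fixes G (structure)
  assumes "group G" and \<rho>: "representation G n \<rho>" and \<sigma>: "representation G m \<sigma>"
    and a: "a < n" and b: "b < m"
  shows "intertwiner G n \<rho> m \<sigma> (averaged_unit_mat G n \<rho> m \<sigma> a b)"
    (is "intertwiner G n \<rho> m \<sigma> ?S")
proof -
  interpret group G by fact
  note \<rho>c = representation_carrier[OF \<rho>] and \<sigma>c = representation_carrier[OF \<sigma>]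
  have S: "?S \<in> carrier_mat n m" by (simp add: averaged_unit_mat_def)
  have "\<rho> h * ?S = ?S * \<sigma> h" if h: "h \<in> carrier G" for h
  proof (rule eq_matI)
    have cancel: "inv h \<otimes> (h \<otimes> g) = g" "h \<otimes> (inv h \<otimes> g) = g" if "g \<in> carrier G" for g
      using h that by (simp_all flip: m_assoc)
    fix c d assume "c < dim_row (?S * \<sigma> h)" "d < dim_col (?S * \<sigma> h)"
    then have c: "c < n" and d: "d < m" using S \<sigma>c[OF h] by auto
    have "(\<rho> h * ?S) $$ (c, d) = (\<Sum>k<n. \<rho> h $$ (c, k) * ?S $$ (k, d))"
      using index_mult_mat_sum[OF \<rho>c[OF h] S c d] .
    also have "\<dots> = (\<Sum>g\<in>carrier G. \<Sum>k<n. \<rho> h $$ (c, k) * \<rho> g $$ (k, a) * \<sigma> (inv g) $$ (b, d))"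
      using d by (subst sum.swap) (simp add: averaged_unit_mat_def sum_distrib_left mult.assoc)
    also have "\<dots> = (\<Sum>g\<in>carrier G. \<rho> (h \<otimes> g) $$ (c, a) * \<sigma> (inv g) $$ (b, d))"
      using h c a by (intro sum.cong refl)
        (simp add: representation_mult[OF \<rho>] index_mult_mat_sum[OF \<rho>c \<rho>c] sum_distrib_right
          del: index_mult_mat(1))
    also have "\<dots> = (\<Sum>g\<in>carrier G. \<rho> g $$ (c, a) * \<sigma> (inv g \<otimes> h) $$ (b, d))"
      using h by (intro sum.reindex_bij_witness[of _ "\<lambda>g. inv h \<otimes> g" "\<lambda>g. h \<otimes> g"])
        (simp_all add: inv_mult_group m_assoc cancel)
    also have "\<dots> = (\<Sum>g\<in>carrier G. \<Sum>k<m. \<rho> g $$ (c, a) * \<sigma> (inv g) $$ (b, k) * \<sigma> h $$ (k, d))"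
      using h b d by (intro sum.cong refl)
        (simp add: representation_mult[OF \<sigma>] index_mult_mat_sum[OF \<sigma>c \<sigma>c] sum_distrib_left mult.assoc
          del: index_mult_mat(1))
    also have "\<dots> = (\<Sum>k<m. ?S $$ (c, k) * \<sigma> h $$ (k, d))"
      using c by (subst sum.swap) (simp add: averaged_unit_mat_def sum_distrib_right)
    also have "\<dots> = (?S * \<sigma> h) $$ (c, d)"
      using index_mult_mat_sum[OF S \<sigma>c[OF h] c d] by simp
    finally show "(\<rho> h * ?S) $$ (c, d) = (?S * \<sigma> h) $$ (c, d)" .
  qed (use S \<rho>c[OF h] \<sigma>c[OF h] in auto)
  with S show ?thesis by (simp add: intertwiner_def)
qed

text \<open>Expanding both traces leaves products of two diagonal entries \<open>\<rho>(g)\<^sub>a\<^sub>a \<sigma>(g\<^sup>-\<^sup>1)\<^sub>b\<^sub>b\<close>; the sum of these over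
  the group is a single entry of an averaged matrix unit, about which Schur's lemma decides.\<close>

lemma character_pairing_eq_averaged_entries:
  fixes G (structure)
  assumes "group G" and \<rho>: "representation G n \<rho>" and \<sigma>: "representation G m \<sigma>"
  shows "(\<Sum>g\<in>carrier G. character_of G \<rho> g * character_of G \<sigma> (inv\<^bsub>G\<^esub> g)) =
         (\<Sum>a<n. \<Sum>b<m. averaged_unit_mat G n \<rho> m \<sigma> a b $$ (a, b))"
proof -
  interpret group G by fact
  have "mat_trace (\<rho> g) = (\<Sum>a<n. \<rho> g $$ (a, a))" "mat_trace (\<sigma> g) = (\<Sum>b<m. \<sigma> g $$ (b, b))"
    if "g \<in> carrier G" for g
    using representation_carrier[OF \<rho> that] representation_carrier[OF \<sigma> that]
    by (auto simp: mat_trace_def)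
  then have "(\<Sum>g\<in>carrier G. character_of G \<rho> g * character_of G \<sigma> (inv g)) =
      (\<Sum>g\<in>carrier G. \<Sum>a<n. \<Sum>b<m. \<rho> g $$ (a, a) * \<sigma> (inv g) $$ (b, b))"
    by (intro sum.cong refl) (simp add: character_of_def sum_product)
  also have "\<dots> = (\<Sum>a<n. \<Sum>g\<in>carrier G. \<Sum>b<m. \<rho> g $$ (a, a) * \<sigma> (inv g) $$ (b, b))"
    by (rule sum.swap)
  also have "\<dots> = (\<Sum>a<n. \<Sum>b<m. \<Sum>g\<in>carrier G. \<rho> g $$ (a, a) * \<sigma> (inv g) $$ (b, b))"
    by (intro sum.cong refl sum.swap)
  finally show ?thesis by (simp add: averaged_unit_mat_def)
qed

text \<open>The average is a scalar matrix by Schur's lemma. The trace is invariant under conjugation, so its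
  trace is \<open>|G|\<close> times that of \<open>E\<^sub>a\<^sub>b\<close>, which determines the scalar.\<close>

lemma averaged_unit_mat_self_diagonal:
  fixes G (structure)
  assumes "group G" and \<rho>: "irreducible_representation G n \<rho>" and a: "a < n" and b: "b < n"
  shows "averaged_unit_mat G n \<rho> n \<rho> a b $$ (a, b) = (if a = b then of_nat (card (carrier G)) / of_nat n else 0)"
proof -
  interpret group G by fact
  let ?S = "averaged_unit_mat G n \<rho> n \<rho> a b"
  have rep: "representation G n \<rho>" and n: "n > 0"
    using \<rho> unfolding irreducible_representation_def by auto
  note \<rho>c = representation_carrier[OF rep]
  obtain c where c: "?S = c \<cdot>\<^sub>m 1\<^sub>m n"
    using self_intertwiner_scalar[OF \<rho> intertwiner_averaged_unit_mat[OF \<open>group G\<close> rep rep a b]] .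
  have "mat_trace ?S = (\<Sum>g\<in>carrier G. \<Sum>k<n. \<rho> (inv g) $$ (b, k) * \<rho> g $$ (k, a))"
    by (subst sum.swap) (simp add: mat_trace_def averaged_unit_mat_def mult.commute)
  also have "\<dots> = (\<Sum>g\<in>carrier G. \<rho> \<one> $$ (b, a))"
    using a b
    by (intro sum.cong refl)
      (simp add: index_mult_mat_sum[OF \<rho>c \<rho>c, symmetric] representation_mult[OF rep, symmetric]
        del: index_mult_mat(1))
  also have "\<dots> = (if a = b then of_nat (card (carrier G)) else 0)"
    using a b by (simp add: representation_one[OF rep] is_group)
  finally have "c * of_nat n = (if a = b then of_nat (card (carrier G)) else 0)"
    by (simp add: c mat_trace_def mult.commute)
  then show ?thesis using a b n by (auto simp: c field_simps)
qed

text \<open>Stated with \<open>\<psi>(g\<^sup>-\<^sup>1)\<close>, which is the complex conjugate of \<open>\<psi>(g)\<close>, because this is the form in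
  which the averaging argument produces it and in which it exhibits an inverse matrix. Equal characters
  may be taken to come from one and the same representation, so only two cases arise: one
  representation, or two without a nonzero intertwiner.\<close>

theorem irreducible_characters_orthogonal:
  assumes "group G" and \<chi>: "\<chi> \<in> irreducible_characters G" and \<psi>: "\<psi> \<in> irreducible_characters G"
  shows "(\<Sum>g\<in>carrier G. \<chi> g * \<psi> (inv\<^bsub>G\<^esub> g)) = (if \<chi> = \<psi> then of_nat (card (carrier G)) else 0)"
proof -
  obtain n \<rho> where \<rho>: "irreducible_representation G n \<rho>" and \<chi>\<rho>: "\<chi> = character_of G \<rho>"
    using \<chi> unfolding irreducible_characters_def by blast
  obtain m \<sigma> where \<sigma>: "irreducible_representation G m \<sigma>" and \<psi>\<sigma>: "\<psi> = character_of G \<sigma>"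
    using \<psi> unfolding irreducible_characters_def by blast
  have rep: "representation G n \<rho>" "representation G m \<sigma>" and n: "n > 0"
    using \<rho> \<sigma> unfolding irreducible_representation_def by auto
  show ?thesis
  proof (cases "\<chi> = \<psi>")
    case True
    have "(\<Sum>g\<in>carrier G. \<chi> g * \<chi> (inv\<^bsub>G\<^esub> g)) =
        (\<Sum>a<n. \<Sum>b<n. if a = b then of_nat (card (carrier G)) / of_nat n else 0)"
      unfolding \<chi>\<rho> character_pairing_eq_averaged_entries[OF \<open>group G\<close> rep(1) rep(1)]
      by (intro sum.cong refl averaged_unit_mat_self_diagonal[OF \<open>group G\<close> \<rho>]) auto
    also have "\<dots> = of_nat (card (carrier G))" using n by simp
    finally show ?thesis using True by simp
  next
    case False
    have "averaged_unit_mat G n \<rho> m \<sigma> a b = 0\<^sub>m n m" if "a < n" "b < m" for a b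
      using False nonzero_intertwiner_character_eq[OF \<rho> \<sigma>
          intertwiner_averaged_unit_mat[OF \<open>group G\<close> rep that]]
      unfolding \<chi>\<rho> \<psi>\<sigma> by blast
    then show ?thesis using False
      unfolding \<chi>\<rho> \<psi>\<sigma> character_pairing_eq_averaged_entries[OF \<open>group G\<close> rep] by simp
  qed
qed

section \<open>Inverses of character tables\<close>

lemma (in group) sum_over_conjugacy_classes:
  fixes f :: "'a \<Rightarrow> 'c :: comm_monoid_add"
  assumes "finite (carrier G)" and "distinct Ks" and "set Ks = conjugacy_classes G"
  shows "(\<Sum>j<length Ks. \<Sum>g\<in>Ks ! j. f g) = (\<Sum>g\<in>carrier G. f g)"
proof -
  interpret conj: group_action G "carrier G" "\<lambda>g. \<lambda>h \<in> carrier G. g \<otimes> h \<otimes> inv g"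
    by (rule action_by_conjugation)
  have "(\<Sum>j<length Ks. \<Sum>g\<in>Ks ! j. f g) = (\<Sum>K\<in>conjugacy_classes G. \<Sum>g\<in>K. f g)"
    using assms(2,3) by (intro sum.reindex_bij_betw bij_betw_nth) auto
  then show ?thesis
    unfolding conjugacy_classes_def by (simp only: conj.disjoint_sum[OF assms(1)])
qed

lemma (in group) Union_conjugacy_classes: "\<Union> (conjugacy_classes G) = carrier G"
proof -
  interpret conj: group_action G "carrier G" "\<lambda>g. \<lambda>h \<in> carrier G. g \<otimes> h \<otimes> inv g"
    by (rule action_by_conjugation)
  show ?thesis using conj.orbits_coverture unfolding conjugacy_classes_def .
qed

lemma (in group) conjugacy_class_subset_nonempty:
  assumes "K \<in> conjugacy_classes G"
  shows "K \<subseteq> carrier G" and "K \<noteq> {}"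
proof -
  show "K \<subseteq> carrier G" using assms Union_conjugacy_classes by blast
  show "K \<noteq> {}" using assms unfolding conjugacy_classes_def orbits_def orbit_def by blast
qed

lemma (in group) one_conjugacy_class: "{\<one>} \<in> conjugacy_classes G"
proof -
  have "orbit G (\<lambda>g. \<lambda>h \<in> carrier G. g \<otimes> h \<otimes> inv g) \<one> = {\<one>}"
    unfolding orbit_def by (auto intro!: exI[of _ \<one>])
  then show ?thesis unfolding conjugacy_classes_def orbits_def by force
qed

text \<open>The entry is the average of \<open>\<chi>(g\<^sup>-\<^sup>1)\<close> over the class, multiplied by \<open>|K| / |G|\<close>. Summing over the
  class instead of choosing a representative turns a matrix product with the table directly into
  a sum over the group.\<close>

definition dual_table ::
    "('a, 'm) monoid_scheme \<Rightarrow> ('a \<Rightarrow> complex) list \<Rightarrow> 'a set list \<Rightarrow> complex mat" where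
  "dual_table G \<chi>s Ks =
     mat (length Ks) (length \<chi>s)
       (\<lambda>(j, i). (\<Sum>g\<in>Ks ! j. (\<chi>s ! i) (inv\<^bsub>G\<^esub> g)) / of_nat (card (carrier G)))"

lemma character_table_right_inverse:
  fixes G (structure)
  assumes "group G" and fin: "finite (carrier G)" and X: "character_table G \<chi>s Ks X"
  shows "X * dual_table G \<chi>s Ks = 1\<^sub>m (length \<chi>s)"
proof (rule eq_matI)
  interpret group G by fact
  let ?B = "dual_table G \<chi>s Ks"
  have Xc: "X \<in> carrier_mat (length \<chi>s) (length Ks)" using X by (simp add: character_table_def)
  have B: "?B \<in> carrier_mat (length Ks) (length \<chi>s)" by (simp add: dual_table_def)
  fix i i' assume "i < dim_row (1\<^sub>m (length \<chi>s) :: complex mat)" "i' < dim_col (1\<^sub>m (length \<chi>s) :: complex mat)"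
  then have i: "i < length \<chi>s" and i': "i' < length \<chi>s" by auto
  have "(X * ?B) $$ (i, i') = (\<Sum>j<length Ks. X $$ (i, j) * ?B $$ (j, i'))"
    by (rule index_mult_mat_sum[OF Xc B i i'])
  also have "\<dots> = (\<Sum>j<length Ks. \<Sum>g\<in>Ks ! j. (\<chi>s ! i) g * (\<chi>s ! i') (inv g) / of_nat (card (carrier G)))"
  proof (intro sum.cong refl)
    fix j assume "j \<in> {..<length Ks}"
    then show "X $$ (i, j) * ?B $$ (j, i') = (\<Sum>g\<in>Ks ! j. (\<chi>s ! i) g * (\<chi>s ! i') (inv g) / of_nat (card (carrier G)))"
      using X i i' unfolding character_table_def dual_table_def
      by (simp add: sum_distrib_left sum_divide_distrib)
  qed
  also have "\<dots> = (\<Sum>g\<in>carrier G. (\<chi>s ! i) g * (\<chi>s ! i') (inv g)) / of_nat (card (carrier G))"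
    using X fin unfolding character_table_def
    by (simp add: sum_over_conjugacy_classes sum_divide_distrib)
  also have "\<dots> = (if \<chi>s ! i = \<chi>s ! i' then 1 else 0)"
    using X fin nth_mem[OF i] nth_mem[OF i'] one_closed
    by (auto simp: character_table_def irreducible_characters_orthogonal[OF \<open>group G\<close>])
  also have "\<dots> = 1\<^sub>m (length \<chi>s) $$ (i, i')"
    using X i i' unfolding character_table_def by (simp add: nth_eq_iff_index_eq)
  finally show "(X * ?B) $$ (i, i') = 1\<^sub>m (length \<chi>s) $$ (i, i')" .
qed (use X in \<open>auto simp: character_table_def dual_table_def\<close>)

text \<open>The factor \<open>N\<close> can be moved around cyclically because \<open>N\<close> and the product of the other factors are
  square, where one-sided inverses are two-sided. This gives the rectangular \<open>X\<close> a left inverse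
  next to its right inverse \<open>C\<close>, and the two must coincide.\<close>

lemma inverse_of_scaled_transpose:
  fixes X :: "'a :: field mat"
  assumes X: "X \<in> carrier_mat k l" and C: "C \<in> carrier_mat l k"
    and E: "E \<in> carrier_mat k k" and N: "N \<in> carrier_mat l l" and B: "B \<in> carrier_mat k l"
    and XC: "X * C = 1\<^sub>m k" and AB: "transpose_mat (E * X * N) * B = 1\<^sub>m l"
  shows "C = N * transpose_mat B * E"
proof -
  let ?Bt = "transpose_mat B"
  let ?P = "?Bt * E * X"
  have Bt: "?Bt \<in> carrier_mat l k" using B by simp
  have BtE: "?Bt * E \<in> carrier_mat l k" and P: "?P \<in> carrier_mat l l" using Bt E X by auto
  have "?P * N = ?Bt * (E * X * N)"
    unfolding assoc_mult_mat[OF Bt E X]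
    by (rule assoc_mult_mat[OF Bt _ N]) (use E X in auto)
  also have "\<dots> = transpose_mat (transpose_mat (E * X * N) * B)"
    using E X N B by (subst transpose_mult[of _ l k _ l]) auto
  also have "\<dots> = 1\<^sub>m l" unfolding AB by simp
  finally have "N * ?P = 1\<^sub>m l"
    by (rule mat_mult_left_right_inverse[OF P N])
  moreover have "N * ?P = (N * ?Bt * E) * X"
    unfolding assoc_mult_mat[OF N Bt E] by (rule assoc_mult_mat[OF N BtE X, symmetric])
  ultimately have left: "(N * ?Bt * E) * X = 1\<^sub>m l" by simp
  show ?thesis
    by (rule left_inverse_mat_eq_right_inverse_mat[OF X C _ left XC, symmetric]) (use Bt E N in auto)
qed

lemma inverse_degree_matrix:
  assumes E: "E \<in> carrier_mat (length \<chi>s) (length \<chi>s)"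
    and inv: "inverts_mat (degree_matrix G \<chi>s) E"
  shows "E = mat_diag (length \<chi>s) (\<lambda>i. 1 / character_degree G (\<chi>s ! i))"
    and "i < length \<chi>s \<Longrightarrow> character_degree G (\<chi>s ! i) \<noteq> 0"
proof -
  let ?k = "length \<chi>s" and ?d = "\<lambda>i. character_degree G (\<chi>s ! i)"
  have prod: "mat ?k ?k (\<lambda>(i, j). ?d i * E $$ (i, j)) = 1\<^sub>m ?k"
    using inv unfolding inverts_mat_def degree_matrix_def mat_diag_mult_left[OF E]
    by (simp add: mat_diag_def)
  have eq: "?d i * E $$ (i, j) = (if i = j then 1 else 0)" if "i < ?k" "j < ?k" for i j
    using that arg_cong[OF prod, of "\<lambda>A. A $$ (i, j)"] by simp
  show nz: "i < ?k \<Longrightarrow> ?d i \<noteq> 0" for i using eq[of i i] by auto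
  show "E = mat_diag ?k (\<lambda>i. 1 / ?d i)"
  proof (rule eq_matI)
    fix i j assume "i < dim_row (mat_diag ?k (\<lambda>i. 1 / ?d i))" "j < dim_col (mat_diag ?k (\<lambda>i. 1 / ?d i))"
    then have ij: "i < ?k" "j < ?k" by (auto simp: mat_diag_def)
    then show "E $$ (i, j) = mat_diag ?k (\<lambda>i. 1 / ?d i) $$ (i, j)"
      using eq[OF ij] nz[OF ij(1)] by (auto simp: mat_diag_def field_simps split: if_splits)
  qed (use E in \<open>auto simp: mat_diag_def\<close>)
qed

section \<open>The scaling matrix and the class sizes\<close>

theorem proposition2p1:
  fixes G :: "('a, 'm) monoid_scheme" and H :: "('b, 'k) monoid_scheme"
    and \<chi>s :: "('a \<Rightarrow> complex) list" and Ks :: "'a set list"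
    and \<psi>s :: "('b \<Rightarrow> complex) list" and Ls :: "'b set list"
    and X D Dinv N :: "complex mat"
  assumes "group G" and "finite (carrier G)"
    and "character_table G \<chi>s Ks X"
    and "D = degree_matrix G \<chi>s"
    and "Dinv \<in> carrier_mat (length \<chi>s) (length \<chi>s)"
    and "inverts_mat D Dinv" and "inverts_mat Dinv D"
    and "N \<in> carrier_mat (length Ks) (length Ks)" and "diagonal_mat N"
    and "group H" and "finite (carrier H)"
    and "character_table H \<psi>s Ls (transpose_mat (Dinv * X * N))"
    and "compatibly_ordered G \<chi>s H Ls"
  shows "N ^\<^sub>m 2 = class_size_matrix Ks"
proof -
  interpret G: group G by fact
  interpret H: group H by fact
  let ?k = "length \<chi>s" and ?l = "length Ks"
  let ?A = "transpose_mat (Dinv * X * N)"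
  let ?B = "dual_table H \<psi>s Ls" and ?C = "dual_table G \<chi>s Ks"
  define d where "d = (\<lambda>i. character_degree G (\<chi>s ! i))"
  define n where "n = (\<lambda>j. N $$ (j, j))"
  note X = assms(3) and N = assms(8) and A = assms(12)

  have Xc: "X \<in> carrier_mat ?k ?l" using X by (simp add: character_table_def)
  have len: "length \<psi>s = ?l" "length Ls = ?k"
    using A assms(5) N by (auto simp: character_table_def)
  have B: "?B \<in> carrier_mat ?k ?l" and C: "?C \<in> carrier_mat ?l ?k"
    by (simp_all add: dual_table_def len)
  have Dinv: "Dinv = mat_diag ?k (\<lambda>i. 1 / d i)" and d: "\<And>i. i < ?k \<Longrightarrow> d i \<noteq> 0"
    using inverse_degree_matrix[OF assms(5)] assms(4,6) unfolding d_def by auto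
  have N_diag: "N = mat_diag ?l n"
    using N assms(9) by (intro eq_matI) (auto simp: mat_diag_def diagonal_mat_def n_def)
  have A_entry: "?A $$ (j, i) = X $$ (i, j) * n j / d i" if "i < ?k" "j < ?l" for i j
    using that Xc unfolding Dinv N_diag
    by (simp add: mat_diag_mult_left[OF Xc] mat_diag_mult_right[of _ ?k])
  have C_eq: "?C = N * transpose_mat ?B * Dinv"
    using inverse_of_scaled_transpose[OF Xc C assms(5) N B]
      character_table_right_inverse[OF assms(1,2) X] character_table_right_inverse[OF assms(10,11) A]
    by (simp add: len)
  have C_entry: "?C $$ (j, i) = n j * ?B $$ (i, j) / d i" if "i < ?k" "j < ?l" for i j
    using that B unfolding C_eq Dinv N_diag
    by (simp add: mat_diag_mult_left[of _ ?l ?k] mat_diag_mult_right[of _ ?l])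

  \<comment> \<open>The column labelled by the trivial character of \<open>G\<close> and the identity class of \<open>H\<close>.\<close>
  obtain i0 where i0: "i0 < ?k" "\<chi>s ! i0 = trivial_character G" "Ls ! i0 = {\<one>\<^bsub>H\<^esub>}"
    using assms(13) unfolding compatibly_ordered_def by auto
  have d0: "d i0 = 1" by (simp add: d_def i0 character_degree_def trivial_character_def)
  have K_class: "Ks ! j \<subseteq> carrier G" "Ks ! j \<noteq> {}" if "j < ?l" for j
    using X G.conjugacy_class_subset_nonempty[of "Ks ! j"] nth_mem[OF that]
    by (simp_all add: character_table_def)
  have psi_one: "(\<psi>s ! j) \<one>\<^bsub>H\<^esub> = n j" if j: "j < ?l" for j
  proof -
    obtain g where g: "g \<in> Ks ! j" using K_class(2)[OF j] by blast
    have "X $$ (i0, j) = 1"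
      using X g j i0 K_class(1)[OF j] by (auto simp: character_table_def trivial_character_def)
    then show ?thesis using A A_entry[OF i0(1) j] j i0 len d0 by (simp add: character_table_def)
  qed
  have sq: "of_nat (card (Ks ! j)) / of_nat (card (carrier G)) = n j * n j / of_nat (card (carrier H))"
    if j: "j < ?l" for j
  proof -
    have "(\<Sum>g\<in>Ks ! j. trivial_character G (inv\<^bsub>G\<^esub> g)) = (\<Sum>g\<in>Ks ! j. 1)"
      using K_class(1)[OF j] by (intro sum.cong refl) (auto simp: trivial_character_def)
    then show ?thesis
      using C_entry[OF i0(1) j] i0 j psi_one[OF j] by (simp add: dual_table_def len d0)
  qed

  \<comment> \<open>The factor of proportionality is determined at the identity class of \<open>G\<close>.\<close>
  obtain j0 where j0: "j0 < ?l" "Ks ! j0 = {\<one>\<^bsub>G\<^esub>}"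
    using X G.one_conjugacy_class unfolding character_table_def by (metis in_set_conv_nth)
  have "(\<psi>s ! j0) h = n j0" if h: "h \<in> carrier H" for h
  proof -
    obtain i where i: "i < ?k" "h \<in> Ls ! i"
      using h A H.Union_conjugacy_classes unfolding character_table_def len by (metis UnionE in_set_conv_nth len(2))
    have "X $$ (i, j0) = d i"
      using X i(1) j0 by (simp add: character_table_def d_def character_degree_def)
    then have "?A $$ (j0, i) = n j0" using A_entry[OF i(1) j0(1)] d[OF i(1)] by simp
    then show ?thesis using A i j0 len by (auto simp: character_table_def)
  qed
  then have "(\<Sum>h\<in>carrier H. (\<psi>s ! j0) h * (\<psi>s ! j0) (inv\<^bsub>H\<^esub> h)) = of_nat (card (carrier H)) * (n j0 * n j0)"
    by simp
  moreover have "\<psi>s ! j0 \<in> irreducible_characters H"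
    using A j0 len by (auto simp: character_table_def)
  moreover have cH: "of_nat (card (carrier H)) \<noteq> (0 :: complex)" and cG: "of_nat (card (carrier G)) \<noteq> (0 :: complex)"
    using assms(2,11) by auto
  ultimately have "n j0 * n j0 = 1"
    using irreducible_characters_orthogonal[OF assms(10), of "\<psi>s ! j0" "\<psi>s ! j0"] by simp
  with sq[OF j0(1)] j0 cG cH have "of_nat (card (carrier H)) = (of_nat (card (carrier G)) :: complex)"
    by (simp add: field_simps)
  with sq cG have "n j * n j = of_nat (card (Ks ! j))" if "j < ?l" for j
    using that by (simp add: field_simps)
  then have "mat_diag ?l (\<lambda>j. n j * n j) = class_size_matrix Ks"
    unfolding class_size_matrix_def by (intro eq_matI) (auto simp: mat_diag_def)
  moreover have "N ^\<^sub>m 2 = N * N" using N by (simp add: numeral_2_eq_2)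
  ultimately show ?thesis unfolding N_diag by simp
qed

end
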